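(* Let $k\ge 1$, $n\ge1$, and let $S\subseteq\{1,2,\ldots,\lfloor n/2\rfloor\}$. Then (a) if $n$ is odd, $\mathrm{opp}_{k,S}(n) = \mathrm{epp}_{k,S}(n)$; and (b) if $n$ is even, $\mathrm{opp}_{k,S}(n) = k\cdot \mathrm{epp}_{k,S}(n-1)$.
   Context: $\Sigma_k = \{0,\ldots,k-1\}$. A palindrome is a word equal to its reverse. A word $w$ has an even palindromic prefix of order $i\ge1$ if $w[1..2i]$ exists and is a palindrome, and an odd palindromic prefix of order $i\ge 1$ if $w[1..2i+1]$ exists and is a palindrome. $\mathrm{epp}_{k,S}(n)$ (resp. $\mathrm{opp}_{k,S}(n)$) is the number of length-$n$ words over $\Sigma_k$ whose set of orders $i\ge1$ of even (resp. odd) palindromic prefixes is exactly $S$. *)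

theory Defs
  imports Main
begin

definition palindrome :: "'a list \<Rightarrow> bool" where
  "palindrome w \<longleftrightarrow> rev w = w"

(* The factor w[1..m] is take m w; since take truncates, "w[1..m] exists" has to be
   required separately as m \<le> length w. *)

definition even_pal_prefix_orders :: "'a list \<Rightarrow> nat set" where
  "even_pal_prefix_orders w =
     {i. i \<ge> 1 \<and> 2 * i \<le> length w \<and> palindrome (take (2 * i) w)}"

definition odd_pal_prefix_orders :: "'a list \<Rightarrow> nat set" where
  "odd_pal_prefix_orders w =
     {i. i \<ge> 1 \<and> 2 * i + 1 \<le> length w \<and> palindrome (take (2 * i + 1) w)}"

definition alphabet :: "nat \<Rightarrow> nat set" where
  "alphabet k = {0..<k}"

definition words :: "nat \<Rightarrow> nat \<Rightarrow> nat list set" where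
  "words k n = {w. length w = n \<and> set w \<subseteq> alphabet k}"

definition epp :: "nat \<Rightarrow> nat set \<Rightarrow> nat \<Rightarrow> nat" where
  "epp k S n = card {w \<in> words k n. even_pal_prefix_orders w = S}"

definition opp :: "nat \<Rightarrow> nat set \<Rightarrow> nat \<Rightarrow> nat" where
  "opp k S n = card {w \<in> words k n. odd_pal_prefix_orders w = S}"

end

theory Submission
  imports Defs
begin

text \<open>
  Fix \<open>T\<close> with maximum \<open>t\<close> and next largest element \<open>s\<close> (order \<open>0\<close> always counts as a member),
  and consider words of length \<open>2 t + \<delta>\<close>, \<open>\<delta> \<in> {0, 1}\<close>, whose prefixes of length \<open>2 i + \<delta>\<close>,
  \<open>i \<in> T\<close>, are palindromes. If \<open>2 s \<ge> t\<close>, such a word is the periodic extension of its prefix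
  of length \<open>2 s + \<delta>\<close>, and \<open>t\<close> may be traded for \<open>2 s - t\<close>. Otherwise it has the form \<open>u x u\<close>,
  where \<open>u\<close> is that prefix and \<open>x\<close> is an arbitrary palindrome of length \<open>2 (t - 2 s) - \<delta>\<close>; there are
  \<open>k ^ (t - 2 s)\<close> of these for either \<open>\<delta>\<close>. Both parities obey the same recursion, so in odd
  length the numbers of words whose orders contain \<open>T\<close> agree, and Moebius inversion
  over the supersets of \<open>T\<close> passes to words whose orders are exactly \<open>T\<close>.
\<close>

section \<open>Words over the alphabet: counting, concatenation, factors\<close>

lemma finite_words [simp]: "finite (words k n)"
proof -
  have "words k n = {w. set w \<subseteq> alphabet k \<and> length w = n}"
    by (auto simp: words_def)
  then show ?thesis
    by (simp add: finite_lists_length_eq alphabet_def)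
qed

lemma card_words: "card (words k n) = k ^ n"
proof -
  have "words k n = {w. set w \<subseteq> alphabet k \<and> length w = n}"
    by (auto simp: words_def)
  then show ?thesis
    by (simp add: card_lists_length_eq alphabet_def)
qed

lemma append_in_words:
  "u \<in> words k m \<Longrightarrow> v \<in> words k n \<Longrightarrow> u @ v \<in> words k (m + n)"
  by (auto simp: words_def)

lemma take_in_words: "w \<in> words k n \<Longrightarrow> m \<le> n \<Longrightarrow> take m w \<in> words k m"
  by (auto simp: words_def dest: in_set_takeD)

lemma drop_in_words: "w \<in> words k n \<Longrightarrow> drop m w \<in> words k (n - m)"
  by (auto simp: words_def dest: in_set_dropD)

section \<open>Words with prescribed palindromic prefix lengths\<close>

text \<open>\<open>L\<close> holds prefix lengths instead of orders, so that one definition serves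
  both parities. As \<open>take\<close> truncates, \<open>L\<close> is only used with elements up to
  \<open>n\<close>.\<close>

definition pal_prefix_words :: "nat \<Rightarrow> nat \<Rightarrow> nat set \<Rightarrow> nat list set" where
  "pal_prefix_words k n L = {w \<in> words k n. \<forall>l\<in>L. palindrome (take l w)}"

text \<open>A property decided by the first \<open>n\<close> letters leaves the last
  \<open>m\<close> letters free.\<close>

lemma card_words_extend:
  assumes "\<And>w. w \<in> words k (n + m) \<Longrightarrow> P w \<longleftrightarrow> P (take n w)"
  shows "card {w \<in> words k (n + m). P w} = card {w \<in> words k n. P w} * k ^ m"
proof -
  have "bij_betw (\<lambda>w. (take n w, drop n w)) {w \<in> words k (n + m). P w}
      ({w \<in> words k n. P w} \<times> words k m)"
  proof (rule bij_betw_byWitness[where f' = "\<lambda>(u, v). u @ v"])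
    show "(\<lambda>w. (take n w, drop n w)) ` {w \<in> words k (n + m). P w}
        \<subseteq> {w \<in> words k n. P w} \<times> words k m"
      using assms take_in_words[of _ k "n + m" n] drop_in_words[of _ k "n + m" n] by auto
    show "(\<lambda>(u, v). u @ v) ` ({w \<in> words k n. P w} \<times> words k m)
        \<subseteq> {w \<in> words k (n + m). P w}"
    proof clarsimp
      fix u v assume u: "u \<in> words k n" "P u" and v: "v \<in> words k m"
      have "take n (u @ v) = u"
        using u by (simp add: words_def)
      with assms[OF append_in_words[OF u(1) v]] u append_in_words[OF u(1) v]
      show "u @ v \<in> words k (n + m) \<and> P (u @ v)" by simp
    qed
  qed (auto simp: words_def)
  then have "card {w \<in> words k (n + m). P w} = card ({w \<in> words k n. P w} \<times> words k m)"
    by (rule bij_betw_same_card)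
  then show ?thesis
    by (simp add: card_cartesian_product card_words)
qed

lemma card_pal_prefix_words_extend:
  assumes "L \<subseteq> {..n}"
  shows "card (pal_prefix_words k (n + m) L) = card (pal_prefix_words k n L) * k ^ m"
  unfolding pal_prefix_words_def
proof (rule card_words_extend)
  fix w
  have "take l (take n w) = take l w" if "l \<in> L" for l
    using assms that by (auto simp: min_def)
  then show "(\<forall>l\<in>L. palindrome (take l w)) \<longleftrightarrow> (\<forall>l\<in>L. palindrome (take l (take n w)))"
    by simp
qed

section \<open>Two nested palindromic prefixes: overlap and border\<close>

text \<open>Reversing \<open>x @ y @ z\<close> gives \<open>rev z @ x @ y\<close>. Cutting off
  suffixes of equal length leaves \<open>y = z\<close> and \<open>rev z @ x = x @ y\<close>;
  comparison with \<open>rev y @ rev x = x @ y\<close> then makes \<open>x\<close> a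
  palindrome.\<close>

lemma palindrome_prefix_periodic:
  assumes "length z = length y"
  shows "palindrome (x @ y) \<and> palindrome (x @ y @ z) \<longleftrightarrow>
    palindrome x \<and> palindrome (x @ y) \<and> z = y"
  (is "?lhs \<longleftrightarrow> ?rhs")
proof
  assume ?lhs
  then have xy: "rev y @ rev x = x @ y" and xyz: "rev z @ (rev y @ rev x) = x @ y @ z"
    unfolding palindrome_def rev_append append_assoc by blast+
  have "(rev z @ x) @ y = (x @ y) @ z"
    by (metis append_assoc xy xyz)
  then have "rev z @ x = x @ y" and "y = z"
    using append_eq_append_conv[OF disjI2, OF assms[symmetric]] by blast+
  moreover from this xy have "rev x = x"
    by (metis same_append_eq)
  ultimately show ?rhs
    using xy by (simp add: palindrome_def)
next
  assume ?rhs
  then show ?lhs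
    by (auto simp: palindrome_def)
qed

text \<open>Reversal swaps the outer blocks, and equal lengths allow a blockwise comparison.\<close>

lemma palindrome_border:
  assumes "length u = length v"
  shows "palindrome u \<and> palindrome (u @ x @ v) \<longleftrightarrow> palindrome u \<and> palindrome x \<and> v = u"
  using assms by (auto simp: palindrome_def append_eq_append_conv)

text \<open>Truncation to length \<open>a\<close> is a bijection: the lost tail repeats the last
  \<open>b - a\<close> letters of the prefix, and the condition at length \<open>b\<close> becomes
  one at length \<open>2 * a - b\<close>.\<close>

lemma card_pal_prefix_words_periodic:
  assumes "a < b" "b \<le> 2 * a" "a \<in> L" "L \<subseteq> {..a}"
  shows "card (pal_prefix_words k b (insert b L)) =
    card (pal_prefix_words k a (insert (2 * a - b) L))"
proof -
  \<comment> \<open>The prefixes of lengths \<open>c\<close>, \<open>a\<close>, \<open>b\<close>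
    grow by equal amounts; they are the \<open>x\<close>, \<open>x @ y\<close>,
    \<open>x @ y @ z\<close> of \<open>palindrome_prefix_periodic\<close>.\<close>
  define c where "c = 2 * a - b"
  have c: "c \<le> a" "a - c = b - a"
    using assms by (auto simp: c_def)
  have key: "palindrome (take a w) \<and> palindrome w \<longleftrightarrow>
      palindrome (take c w) \<and> palindrome (take a w) \<and> drop a w = drop c (take a w)"
    if "length w = b" for w :: "nat list"
  proof -
    have "take a w = take c w @ drop c (take a w)"
      using c by (metis append_take_drop_id min.absorb1 take_take)
    then have eq: "take c w @ drop c (take a w) = take a w"
      "take c w @ drop c (take a w) @ drop a w = w"
      by (metis, metis append_assoc append_take_drop_id)
    have "length (drop a w) = length (drop c (take a w))"
      using that c assms by simp
    from palindrome_prefix_periodic[OF this, of "take c w"] show ?thesis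
      unfolding eq .
  qed
  have take_L: "take l (take a w) = take l w" if "l \<in> L" for l and w :: "nat list"
    using assms that by (auto simp: min_def)
  have take_c: "take c (take a w) = take c w" for w :: "nat list"
    using c by (simp add: min_def)
  have "bij_betw (take a) (pal_prefix_words k b (insert b L)) (pal_prefix_words k a (insert c L))"
  proof (rule bij_betw_byWitness[where f' = "\<lambda>u. u @ drop c u"])
    show "\<forall>w\<in>pal_prefix_words k b (insert b L). take a w @ drop c (take a w) = w"
    proof
      fix w assume "w \<in> pal_prefix_words k b (insert b L)"
      then have "length w = b" "palindrome (take a w)" "palindrome w"
        using assms by (auto simp: pal_prefix_words_def words_def)
      with key show "take a w @ drop c (take a w) = w"
        by (metis append_take_drop_id)
    qed
    show "\<forall>u\<in>pal_prefix_words k a (insert c L). take a (u @ drop c u) = u"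
      by (auto simp: pal_prefix_words_def words_def)
    show "take a ` pal_prefix_words k b (insert b L) \<subseteq> pal_prefix_words k a (insert c L)"
    proof clarify
      fix w assume w: "w \<in> pal_prefix_words k b (insert b L)"
      then have "length w = b" "palindrome (take a w)" "palindrome w"
        using assms by (auto simp: pal_prefix_words_def words_def)
      with key have "palindrome (take c w)" by blast
      with w show "take a w \<in> pal_prefix_words k a (insert c L)"
        using take_in_words[of w k b a] assms
        by (auto simp: pal_prefix_words_def take_L take_c simp del: take_take)
    qed
    show "(\<lambda>u. u @ drop c u) ` pal_prefix_words k a (insert c L)
        \<subseteq> pal_prefix_words k b (insert b L)"
    proof clarify
      fix u assume u: "u \<in> pal_prefix_words k a (insert c L)"
      define w where "w = u @ drop c u"
      have len: "length u = a" and uw: "u \<in> words k a"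
        using u by (auto simp: pal_prefix_words_def words_def)
      have tw: "take a w = u" "drop a w = drop c u"
        using len by (auto simp: w_def)
      have "w \<in> words k (a + (a - c))"
        unfolding w_def by (intro append_in_words uw drop_in_words)
      then have ww: "w \<in> words k b"
        using c assms by simp
      have lw: "length w = b"
        using ww by (simp add: words_def)
      have "palindrome (take c w)" "palindrome (take a w)"
        using u assms(3) len take_c[of w] by (auto simp: pal_prefix_words_def tw simp del: take_take)
      with key[OF lw] tw have "palindrome w" by auto
      moreover have "palindrome (take l w)" if "l \<in> L" for l
      proof -
        have "take l w = take l u"
          using take_L[OF that, of w] by (simp only: tw)
        then show ?thesis
          using u that by (simp add: pal_prefix_words_def)
      qed
      ultimately show "w \<in> pal_prefix_words k b (insert b L)"
        using ww lw by (auto simp: pal_prefix_words_def)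
    qed
  qed
  then show ?thesis
    unfolding c_def by (rule bij_betw_same_card)
qed

text \<open>Two copies of the prefix of length \<open>a\<close> fit without overlap, so the word is
  \<open>u @ x @ u\<close>, and \<open>u\<close> and the palindrome \<open>x\<close> can be chosen
  independently.\<close>

lemma card_pal_prefix_words_border:
  assumes "2 * a \<le> b" "a \<in> L" "L \<subseteq> {..a}"
  shows "card (pal_prefix_words k b (insert b L)) =
    card (pal_prefix_words k a L) * card (pal_prefix_words k (b - 2 * a) {b - 2 * a})"
proof -
  define c where "c = b - 2 * a"
  have b: "b = a + (c + a)"
    using assms by (simp add: c_def)
  have take_L: "take l (take a w) = take l w" if "l \<in> L" for l and w :: "nat list"
    using assms that by (auto simp: min_def)
  have dec: "w = take a w @ take c (drop a w) @ drop (a + c) w" for w :: "nat list"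
    by (metis add.commute append_take_drop_id drop_drop)
  have key: "palindrome (take a w) \<and> palindrome w \<longleftrightarrow>
      palindrome (take a w) \<and> palindrome (take c (drop a w)) \<and> drop (a + c) w = take a w"
    if "length w = b" for w :: "nat list"
  proof -
    have "length (take a w) = length (drop (a + c) w)"
      using that b by simp
    from palindrome_border[OF this, of "take c (drop a w)"] show ?thesis
      unfolding dec[symmetric] .
  qed
  have "bij_betw (\<lambda>w. (take a w, take c (drop a w))) (pal_prefix_words k b (insert b L))
      (pal_prefix_words k a L \<times> pal_prefix_words k c {c})"
  proof (rule bij_betw_byWitness[where f' = "\<lambda>(u, x). u @ x @ u"])
    show "\<forall>w\<in>pal_prefix_words k b (insert b L).
        (case (take a w, take c (drop a w)) of (u, x) \<Rightarrow> u @ x @ u) = w"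
    proof
      fix w assume "w \<in> pal_prefix_words k b (insert b L)"
      then have "length w = b" "palindrome (take a w)" "palindrome w"
        using assms by (auto simp: pal_prefix_words_def words_def)
      with key have "drop (a + c) w = take a w" by blast
      with dec[of w]
      show "(case (take a w, take c (drop a w)) of (u, x) \<Rightarrow> u @ x @ u) = w"
        by (simp only: prod.case)
    qed
    show "\<forall>p\<in>pal_prefix_words k a L \<times> pal_prefix_words k c {c}.
        (take a (case p of (u, x) \<Rightarrow> u @ x @ u),
         take c (drop a (case p of (u, x) \<Rightarrow> u @ x @ u))) = p"
      by (auto simp: pal_prefix_words_def words_def)
    show "(\<lambda>w. (take a w, take c (drop a w))) ` pal_prefix_words k b (insert b L)
        \<subseteq> pal_prefix_words k a L \<times> pal_prefix_words k c {c}"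
    proof clarify
      fix w assume w: "w \<in> pal_prefix_words k b (insert b L)"
      then have "length w = b" "palindrome (take a w)" "palindrome w" and ww: "w \<in> words k b"
        using assms by (auto simp: pal_prefix_words_def words_def)
      with key have "palindrome (take c (drop a w))" by blast
      moreover have "take c (drop a w) \<in> words k c"
        using take_in_words[OF drop_in_words[OF ww, of a], of c] b by simp
      moreover have "take a w \<in> words k a"
        using take_in_words[OF ww, of a] b by simp
      ultimately show "take a w \<in> pal_prefix_words k a L \<and>
          take c (drop a w) \<in> pal_prefix_words k c {c}"
        using w by (auto simp: pal_prefix_words_def take_L simp del: take_take)
    qed
    show "(\<lambda>(u, x). u @ x @ u) ` (pal_prefix_words k a L \<times> pal_prefix_words k c {c})
        \<subseteq> pal_prefix_words k b (insert b L)"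
    proof clarify
      fix u x assume u: "u \<in> pal_prefix_words k a L" and x: "x \<in> pal_prefix_words k c {c}"
      define w where "w = u @ x @ u"
      have len: "length u = a" "length x = c" and uw: "u \<in> words k a" and xw: "x \<in> words k c"
        using u x by (auto simp: pal_prefix_words_def words_def)
      have ww: "w \<in> words k b"
        unfolding w_def b by (intro append_in_words uw xw)
      have lw: "length w = b"
        using ww by (simp add: words_def)
      have tw: "take a w = u"
        using len by (auto simp: w_def)
      have "palindrome u" "palindrome x"
        using u x assms(2) len by (auto simp: pal_prefix_words_def)
      then have "palindrome w"
        by (simp add: w_def palindrome_def)
      moreover have "palindrome (take l w)" if "l \<in> L" for l
      proof -
        have "take l w = take l u"
          using take_L[OF that, of w] by (simp only: tw)
        then show ?thesis
          using u that by (simp add: pal_prefix_words_def)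
      qed
      ultimately show "w \<in> pal_prefix_words k b (insert b L)"
        using ww lw by (auto simp: pal_prefix_words_def)
    qed
  qed
  then show ?thesis
    unfolding c_def by (simp add: bij_betw_same_card flip: card_cartesian_product)
qed

section \<open>Counting palindromes and comparing the two parities\<close>

lemma palindrome_short: "length w \<le> 1 \<Longrightarrow> palindrome w"
  by (cases w) (auto simp: palindrome_def)

lemma card_palindromes: "card (pal_prefix_words k n {n}) = k ^ ((n + 1) div 2)"
proof (induction n rule: less_induct)
  case (less n)
  have short: "pal_prefix_words k m {m} = words k m" if "m \<le> 1" for m
    using that by (auto simp: pal_prefix_words_def words_def intro!: palindrome_short)
  show ?case
  proof (cases "n \<le> 1")
    case True
    then have "n = 0 \<or> n = 1" by auto
    then show ?thesis
      by (auto simp: short card_words)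
  next
    case False
    \<comment> \<open>Length \<open>1\<close> imposes no condition, but lets the border count apply
      with \<open>a = 1\<close>: peeling off the equal outer letters yields a factor
      \<open>k\<close> and lowers \<open>n\<close> by 2.\<close>
    have "pal_prefix_words k n {n} = pal_prefix_words k n (insert n {1})"
      by (auto simp: pal_prefix_words_def intro!: palindrome_short)
    then have "card (pal_prefix_words k n {n}) = k * k ^ ((n - 2 + 1) div 2)"
      using False less.IH[of "n - 2"]
      by (simp add: card_pal_prefix_words_border[of 1 n] short[of 1, simplified] card_words)
    also have "\<dots> = k ^ Suc ((n - 2 + 1) div 2)"
      by simp
    also have "Suc ((n - 2 + 1) div 2) = (n + 1) div 2"
      using False by simp
    finally show ?thesis .
  qed
qed

text \<open>The factor \<open>k\<close> arises at \<open>t = 0\<close>, where \<open>k\<close>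
  one-letter words face the single empty word; each step of the recursion preserves it.\<close>

lemma card_odd_even_pal_prefix_words:
  assumes "0 \<in> T" "t \<in> T" "T \<subseteq> {..t}"
  shows "card (pal_prefix_words k (2 * t + 1) ((\<lambda>i. 2 * i + 1) ` T)) =
    k * card (pal_prefix_words k (2 * t) ((\<lambda>i. 2 * i) ` T))"
  using assms
proof (induction t arbitrary: T rule: less_induct)
  case (less t T)
  show ?case
  proof (cases "t = 0")
    case True
    then have "T = {0}"
      using less.prems by auto
    then show ?thesis
      using True card_palindromes[of k 1] card_palindromes[of k 0] by simp
  next
    case False
    \<comment> \<open>Since \<open>t\<close> is positive, \<open>0\<close> stays in
      \<open>U\<close>, so the next largest order \<open>s\<close> exists.\<close>
    define U where "U = T - {t}"
    define s where "s = Max U"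
    have U: "finite U" "0 \<in> U" "T = insert t U"
      using less.prems False by (auto simp: U_def intro: finite_subset)
    have s: "s \<in> U" "U \<subseteq> {..s}"
      using U(1,2) Max_in[of U] Max_ge[of U] unfolding s_def by blast+
    have st: "s < t"
      using s less.prems by (auto simp: U_def)
    show ?thesis
    proof (cases "t \<le> 2 * s")
      case True
      have "card (pal_prefix_words k (2 * t + 1) ((\<lambda>i. 2 * i + 1) ` T)) =
          card (pal_prefix_words k (2 * s + 1)
            (insert (2 * (2 * s + 1) - (2 * t + 1)) ((\<lambda>i. 2 * i + 1) ` U)))"
        unfolding U(3) image_insert
        by (rule card_pal_prefix_words_periodic) (use True s st in auto)
      \<comment> \<open>The traded length again has the form \<open>2 * i + 1\<close>, with the same
        order \<open>i = 2 * s - t\<close> as in the even case, so the induction hypothesis for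
        \<open>s\<close> covers both.\<close>
      also have "2 * (2 * s + 1) - (2 * t + 1) = 2 * (2 * s - t) + 1"
        using True by simp
      also have "insert (2 * (2 * s - t) + 1) ((\<lambda>i. 2 * i + 1) ` U) =
          (\<lambda>i. 2 * i + 1) ` insert (2 * s - t) U"
        by simp
      also have "card (pal_prefix_words k (2 * s + 1) \<dots>) =
          k * card (pal_prefix_words k (2 * s) ((\<lambda>i. 2 * i) ` insert (2 * s - t) U))"
        by (rule less.IH) (use s st U in auto)
      also have "(\<lambda>i. 2 * i) ` insert (2 * s - t) U =
          insert (2 * (2 * s) - 2 * t) ((\<lambda>i. 2 * i) ` U)"
        by (simp add: diff_mult_distrib2)
      also have "card (pal_prefix_words k (2 * s) \<dots>) =
          card (pal_prefix_words k (2 * t) ((\<lambda>i. 2 * i) ` T))"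
        unfolding U(3) image_insert
        by (rule card_pal_prefix_words_periodic[symmetric]) (use True s st in auto)
      finally show ?thesis .
    next
      case False
      have "card (pal_prefix_words k (2 * t + 1) ((\<lambda>i. 2 * i + 1) ` T)) =
          card (pal_prefix_words k (2 * s + 1) ((\<lambda>i. 2 * i + 1) ` U)) *
          k ^ ((2 * t + 1 - 2 * (2 * s + 1) + 1) div 2)"
        unfolding U(3) image_insert card_palindromes[symmetric]
        by (rule card_pal_prefix_words_border) (use False s in auto)
      \<comment> \<open>The middle blocks differ in length by one, but half of either length,
        rounded up, is \<open>t - 2 * s\<close>.\<close>
      also have "(2 * t + 1 - 2 * (2 * s + 1) + 1) div 2 = (2 * t - 2 * (2 * s) + 1) div 2"
        using False by presburger
      also have "card (pal_prefix_words k (2 * s + 1) ((\<lambda>i. 2 * i + 1) ` U)) =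
          k * card (pal_prefix_words k (2 * s) ((\<lambda>i. 2 * i) ` U))"
        by (rule less.IH) (use s st U in auto)
      also have "\<dots> * k ^ ((2 * t - 2 * (2 * s) + 1) div 2) =
          k * (card (pal_prefix_words k (2 * s) ((\<lambda>i. 2 * i) ` U)) *
            k ^ ((2 * t - 2 * (2 * s) + 1) div 2))"
        by simp
      also have "card (pal_prefix_words k (2 * s) ((\<lambda>i. 2 * i) ` U)) *
            k ^ ((2 * t - 2 * (2 * s) + 1) div 2) =
          card (pal_prefix_words k (2 * t) ((\<lambda>i. 2 * i) ` T))"
        unfolding U(3) image_insert card_palindromes[symmetric]
        by (rule card_pal_prefix_words_border[symmetric]) (use False s in auto)
      finally show ?thesis .
    qed
  qed
qed

section \<open>From orders containing a set to orders equal to it\<close>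

text \<open>The words with \<open>T \<subseteq> f w\<close> split by the exact value of
  \<open>f w\<close>. Induction on the number of elements of \<open>U\<close> missing from
  \<open>T\<close> settles all strictly larger values, and subtraction leaves the value
  \<open>T\<close>.\<close>

lemma card_level_sets_eq:
  assumes "finite W" "finite U"
    and sub: "\<And>w. w \<in> W \<Longrightarrow> f w \<subseteq> U" "\<And>w. w \<in> W \<Longrightarrow> g w \<subseteq> U"
    and eq: "\<And>T. T \<subseteq> U \<Longrightarrow> card {w \<in> W. T \<subseteq> f w} = card {w \<in> W. T \<subseteq> g w}"
  shows "card {w \<in> W. f w = T} = card {w \<in> W. g w = T}"
proof (cases "T \<subseteq> U")
  case False
  then have "{w \<in> W. f w = T} = {}" "{w \<in> W. g w = T} = {}"
    using sub by auto
  then show ?thesis by (simp only:)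
next
  case True
  then show ?thesis
  proof (induction "card (U - T)" arbitrary: T rule: less_induct)
    case (less T)
    define V where "V = {X. T \<subset> X \<and> X \<subseteq> U}"
    have finV: "finite V"
      using assms(2) by (auto simp: V_def intro: finite_subset[of _ "Pow U"])
    have split: "card {w \<in> W. T \<subseteq> h w} =
        card {w \<in> W. h w = T} + (\<Sum>X\<in>V. card {w \<in> W. h w = X})"
      if "\<And>w. w \<in> W \<Longrightarrow> h w \<subseteq> U" for h
    proof -
      have "{w \<in> W. T \<subseteq> h w} = (\<Union>X\<in>insert T V. {w \<in> W. h w = X})"
        using that less.prems by (auto simp: V_def)
      then have "card {w \<in> W. T \<subseteq> h w} = (\<Sum>X\<in>insert T V. card {w \<in> W. h w = X})"
        using finV assms(1) by (simp only:) (rule card_UN_disjoint, auto)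
      then show ?thesis
        using finV by (simp add: V_def)
    qed
    have "card {w \<in> W. f w = X} = card {w \<in> W. g w = X}" if "X \<in> V" for X
      using that assms(2) by (intro less(1) psubset_card_mono) (auto simp: V_def)
    then have "(\<Sum>X\<in>V. card {w \<in> W. f w = X}) = (\<Sum>X\<in>V. card {w \<in> W. g w = X})"
      by (rule sum.cong[OF refl])
    then show ?case
      using split[OF sub(1)] split[OF sub(2)] eq[OF less.prems] by simp
  qed
qed

section \<open>The two parities of the word length\<close>

lemma opp_eq_epp_odd: "opp k S (2 * m + 1) = epp k S (2 * m + 1)"
  unfolding opp_def epp_def
proof (rule card_level_sets_eq[where U = "{1..m}"])
  fix T assume T: "T \<subseteq> {1..m}"
  \<comment> \<open>Order \<open>0\<close> stands for a prefix of length 0 or 1, always a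
    palindrome; adding it costs nothing and covers empty \<open>T\<close>.\<close>
  define t where "t = Max (insert 0 T)"
  have fin: "finite (insert 0 T)"
    using T finite_subset by auto
  have t: "t \<in> insert 0 T" "insert 0 T \<subseteq> {..t}"
    using Max_in[OF fin] Max_ge[OF fin] unfolding t_def by blast+
  have tm: "t \<le> m"
    using t T by auto
  have img: "(\<lambda>i. 2 * i + 1) ` insert 0 T \<subseteq> {..2 * t + 1}"
    "(\<lambda>i. 2 * i) ` insert 0 T \<subseteq> {..2 * t}"
    using t(2) by auto
  \<comment> \<open>The even case has one more free letter after its longest prescribed prefix,
    which makes up for the factor \<open>k\<close> between the two prefix counts.\<close>
  have exps: "2 * t + 1 + 2 * (m - t) = 2 * m + 1" "2 * t + (2 * (m - t) + 1) = 2 * m + 1"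
    using tm by simp_all
  have "{w \<in> words k (2 * m + 1). T \<subseteq> odd_pal_prefix_orders w} =
      pal_prefix_words k (2 * m + 1) ((\<lambda>i. 2 * i + 1) ` insert 0 T)"
    using T by (fastforce simp: pal_prefix_words_def odd_pal_prefix_orders_def words_def
        intro: palindrome_short)
  moreover have "card \<dots> =
      card (pal_prefix_words k (2 * t + 1) ((\<lambda>i. 2 * i + 1) ` insert 0 T)) * k ^ (2 * (m - t))"
    using card_pal_prefix_words_extend[of "(\<lambda>i. 2 * i + 1) ` insert 0 T" "2 * t + 1" k "2 * (m - t)"]
      img exps by (simp only:)
  moreover have "{w \<in> words k (2 * m + 1). T \<subseteq> even_pal_prefix_orders w} =
      pal_prefix_words k (2 * m + 1) ((\<lambda>i. 2 * i) ` insert 0 T)"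
    using T by (fastforce simp: pal_prefix_words_def even_pal_prefix_orders_def words_def
        intro: palindrome_short)
  moreover have "card \<dots> =
      card (pal_prefix_words k (2 * t) ((\<lambda>i. 2 * i) ` insert 0 T)) * k ^ (2 * (m - t) + 1)"
    using card_pal_prefix_words_extend[of "(\<lambda>i. 2 * i) ` insert 0 T" "2 * t" k "2 * (m - t) + 1"]
      img exps by (simp only:)
  ultimately show "card {w \<in> words k (2 * m + 1). T \<subseteq> odd_pal_prefix_orders w} =
      card {w \<in> words k (2 * m + 1). T \<subseteq> even_pal_prefix_orders w}"
    using card_odd_even_pal_prefix_words[OF _ t, of k] by simp
next
  show "finite (words k (2 * m + 1))"
    by (rule finite_words)
qed (auto simp: odd_pal_prefix_orders_def even_pal_prefix_orders_def words_def)

text \<open>No prefix of odd length reaches the last letter of a word of even length, so that letter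
  is free.\<close>

lemma opp_Suc_odd: "opp k S (2 * m + 2) = k * opp k S (2 * m + 1)"
proof -
  have "odd_pal_prefix_orders w = odd_pal_prefix_orders (take (2 * m + 1) w)"
    if "length w = 2 * m + 2" for w :: "nat list"
  proof -
    have "2 * i + 1 \<le> 2 * m + 2 \<longleftrightarrow> 2 * i + 1 \<le> 2 * m + 1" for i :: nat
      by presburger
    then show ?thesis
      using that by (auto simp: odd_pal_prefix_orders_def min_def)
  qed
  then show ?thesis
    using card_words_extend[of k "2 * m + 1" 1 "\<lambda>w. odd_pal_prefix_orders w = S"]
    by (simp add: opp_def words_def)
qed

theorem theorem7:
  fixes k n :: nat and S :: "nat set"
  assumes "k \<ge> 1" and "n \<ge> 1" and "S \<subseteq> {1..n div 2}"
  shows "(odd n \<longrightarrow> opp k S n = epp k S n) \<and>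
         (even n \<longrightarrow> opp k S n = k * epp k S (n - 1))"
proof (intro conjI impI)
  assume "odd n"
  then obtain m where "n = 2 * m + 1"
    by (rule oddE)
  then show "opp k S n = epp k S n"
    by (simp only: opp_eq_epp_odd)
next
  assume "even n"
  then obtain j where "n = 2 * j"
    by (rule evenE)
  with assms(2) obtain m where "n = 2 * m + 2"
    by (cases j) auto
  then show "opp k S n = k * epp k S (n - 1)"
    using opp_Suc_odd[of k S m] opp_eq_epp_odd[of k S m] by simp
qed

end
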